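(* Let $j\ge 0$ be an integer, let $V(\cdot;j)\in\mathcal{A}$ and $\theta_j\in(0,\pi]$, let $b\ge 0$ be such that $V(x;j)=0$ for $x>b$, and suppose the Schrödinger operator with potential $V(\cdot;j)$ and boundary parameter $\theta_j$ has its bound states exactly at $k=i\gamma_s$, $s=1,\dots,j$ (none if $j=0$). Let $F(k;j)$ and $\varphi(k,x;j)$ be the corresponding Jost function and regular solution. Let $\gamma_{j+1}>0$ be different from $\gamma_1,\dots,\gamma_j$, let $g_{j+1}>0$, and let $V(\cdot;j+1)$ be the potential obtained by adding a bound state at $k=i\gamma_{j+1}$ with Gel'fand–Levitan norming constant $g_{j+1}$. Then the support of $V(\cdot;j+1)$ is also confined to $(0,b)$ if and only if $$F(-i\gamma_{j+1};j)=0\quad\text{and}\quad g_{j+1}^2=\frac{2\gamma_{j+1}}{\varphi(i\gamma_{j+1},b;j)^2-2\gamma_{j+1}\int_0^b\varphi(i\gamma_{j+1},y;j)^2\,dy}.$$ (The second condition implies that its right-hand side must be positive.) When these two conditions are satisfied, $V(\cdot;j+1)$ belongs to the class $\mathcal{A}$.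
   Context: The class $\mathcal{A}$ consists of real-valued integrable potentials $V$ on $\mathbb{R}^+=(0,\infty)$ for which there is $b\ge0$ with $V(x)=0$ for $x>b$ (a.e. identification). The Schrödinger operator with potential $V$ and boundary parameter $\theta\in(0,\pi]$ is given by $-\psi''+V\psi=k^2\psi$ on $\mathbb{R}^+$ with $(\sin\theta)\psi'(0)+(\cos\theta)\psi(0)=0$. Jost solution: $f(k,x)$ with $f(k,x)=e^{ikx}$ for $x\ge b$. Jost function: $F(k)=-i[f'(k,0)+\cot\theta\,f(k,0)]$ if $\theta\in(0,\pi)$, $F(k)=f(k,0)$ if $\theta=\pi$; it is entire in $k$, and the bound states are its zeros in the open upper half-plane, which are simple and lie on the positive imaginary axis. Regular solution: $\varphi(k,0)=1$, $\varphi'(k,0)=-\cot\theta$ if $\theta\in(0,\pi)$; $\varphi(k,0)=0$, $\varphi'(k,0)=1$ if $\theta=\pi$. Adding a bound state at $k=i\gamma_{j+1}$ with norming constant $g_{j+1}$ (leaving the rest of the spectral data unchanged) means passing, by the Darboux transformation, to $$V(x;j+1)=V(x;j)-\frac{d}{dx}\left[\frac{2g_{j+1}^2\,\varphi(i\gamma_{j+1},x;j)^2}{1+g_{j+1}^2\int_0^x\varphi(i\gamma_{j+1},y;j)^2dy}\right]$$ with boundary parameter given by $\cot\theta_{j+1}=\cot\theta_j+g_{j+1}^2$ if $\theta_j\in(0,\pi)$ and $\theta_{j+1}=\pi$ if $\theta_j=\pi$. "The support of $V(\cdot;j+1)$ is confined to $(0,b)$" means $V(x;j+1)=0$ for (almost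 every) $x>b$. *)

theory Defs
  imports "HOL-Analysis.Analysis"
begin

text \<open>
  Potentials are functions on the whole real line of which only the values on \<open>(0,\<infinity>)\<close>,
  up to null sets, are relevant.
\<close>

definition class_A :: "(real \<Rightarrow> real) set" where
  "class_A = {V. V absolutely_integrable_on {0<..} \<and>
                 (\<exists>b\<ge>0. AE x in lebesgue. b < x \<longrightarrow> V x = 0)}"

text \<open>
  For a merely integrable potential, \<open>-\<psi>'' + V \<psi> = k\<^sup>2 \<psi>\<close> is understood in the Caratheodory
  sense: \<open>\<psi>\<close> is differentiable on \<open>[0,\<infinity>)\<close> (one-sidedly at 0) and \<open>\<psi>'\<close> is the indefinite
  integral of \<open>(V - k\<^sup>2) \<psi>\<close>, i.e. \<open>\<psi>'\<close> is locally absolutely continuous and the equation holds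
  almost everywhere. Values of \<open>\<psi>\<close> on the negative axis play no role.
\<close>

definition schroedinger_solution ::
    "(real \<Rightarrow> real) \<Rightarrow> complex \<Rightarrow> (real \<Rightarrow> complex) \<Rightarrow> bool" where
  "schroedinger_solution V k \<psi> \<longleftrightarrow>
     (\<exists>\<psi>'. \<forall>x\<ge>0.
        (\<psi> has_vector_derivative \<psi>' x) (at x within {0..}) \<and>
        ((\<lambda>t. (complex_of_real (V t) - k\<^sup>2) * \<psi> t) has_integral (\<psi>' x - \<psi>' 0)) {0..x})"

definition regular_solution ::
    "(real \<Rightarrow> real) \<Rightarrow> real \<Rightarrow> complex \<Rightarrow> (real \<Rightarrow> complex) \<Rightarrow> bool" where
  "regular_solution V \<theta> k \<phi> \<longleftrightarrow>
     schroedinger_solution V k \<phi> \<and>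
     (if \<theta> = pi
      then \<phi> 0 = 0 \<and> (\<phi> has_vector_derivative 1) (at 0 within {0..})
      else \<phi> 0 = 1 \<and> (\<phi> has_vector_derivative complex_of_real (- cot \<theta>)) (at 0 within {0..}))"

text \<open>
  On \<open>[0,\<infinity>)\<close> the Jost solution does not depend on the choice of \<open>b\<close> with \<open>V = 0\<close> beyond \<open>b\<close>.
\<close>

definition jost_solution ::
    "(real \<Rightarrow> real) \<Rightarrow> complex \<Rightarrow> (real \<Rightarrow> complex) \<Rightarrow> bool" where
  "jost_solution V k f \<longleftrightarrow>
     schroedinger_solution V k f \<and>
     (\<exists>b\<ge>0. (AE x in lebesgue. b < x \<longrightarrow> V x = 0) \<and>
            (\<forall>x\<ge>b. f x = exp (\<i> * k * complex_of_real x)))"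

definition jost_function ::
    "(real \<Rightarrow> real) \<Rightarrow> real \<Rightarrow> (complex \<Rightarrow> complex) \<Rightarrow> bool" where
  "jost_function V \<theta> F \<longleftrightarrow>
     (\<forall>k. \<exists>f. jost_solution V k f \<and>
        F k = (if \<theta> = pi then f 0
               else - \<i> * (vector_derivative f (at 0 within {0..})
                           + complex_of_real (cot \<theta>) * f 0)))"

definition bound_states :: "(complex \<Rightarrow> complex) \<Rightarrow> complex set" where
  "bound_states F = {k. 0 < Im k \<and> F k = 0}"

text \<open>
  Below, \<open>\<phi>\<close> is the regular solution of the unperturbed problem as a function of \<open>k\<close> and \<open>x\<close>.
  At \<open>k = i\<gamma>\<close> the equation and the initial data are real, so \<open>\<phi>(i\<gamma>,\<cdot>)\<close> is real-valued on
  \<open>[0,\<infinity>)\<close>; \<open>Re\<close> only converts the type.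
\<close>

definition darboux_potential ::
    "(real \<Rightarrow> real) \<Rightarrow> (complex \<Rightarrow> real \<Rightarrow> complex) \<Rightarrow> real \<Rightarrow> real \<Rightarrow> real \<Rightarrow> real" where
  "darboux_potential V \<phi> \<gamma> g x =
     (let u = (\<lambda>y. Re (\<phi> (\<i> * complex_of_real \<gamma>) y)) in
      V x - deriv (\<lambda>s. 2 * g\<^sup>2 * (u s)\<^sup>2 / (1 + g\<^sup>2 * integral {0..s} (\<lambda>y. (u y)\<^sup>2))) x)"

definition adds_bound_state ::
    "(real \<Rightarrow> real) \<Rightarrow> real \<Rightarrow> (complex \<Rightarrow> real \<Rightarrow> complex) \<Rightarrow> real \<Rightarrow> real
       \<Rightarrow> (real \<Rightarrow> real) \<Rightarrow> real \<Rightarrow> bool" where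
  "adds_bound_state V \<theta> \<phi> \<gamma> g W \<theta>' \<longleftrightarrow>
     (AE x in lebesgue. 0 < x \<longrightarrow> W x = darboux_potential V \<phi> \<gamma> g x) \<and>
     (if \<theta> = pi then \<theta>' = pi
      else \<theta>' \<in> {0<..<pi} \<and> cot \<theta>' = cot \<theta> + g\<^sup>2)"

end

theory Submission
  imports Defs
begin

text \<open>
  Put \<open>\<gamma> = \<gamma>\<^bsub>j+1\<^esub>\<close>, \<open>u = \<phi>(\<i>\<gamma>, \<cdot>)\<close>, \<open>D(x) = 1 + g\<^sup>2 \<integral>\<^sub>0\<^sup>x u\<^sup>2\<close> and \<open>p = 2 g\<^sup>2 u\<^sup>2 / D\<close>, so that the new potential
  is \<open>V - p'\<close>. Beyond \<open>b\<close> it vanishes iff \<open>p\<close> is constant there, say \<open>p = c\<close>. Differentiating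
  \<open>2 g\<^sup>2 u\<^sup>2 = c D\<close> gives \<open>u' = (c/4) u\<close>, which is only compatible with
  \<open>u = A exp(\<gamma>x) + B exp(-\<gamma>x)\<close> and \<open>c \<ge> 0\<close> if \<open>B = 0\<close> and \<open>c = 4\<gamma>\<close>; then
  \<open>g\<^sup>2 u(b)\<^sup>2 = 2 \<gamma> D(b)\<close> is the condition on the norming constant.
  Constancy of the Wronskian of \<open>u\<close> and the Jost solution at \<open>k = -\<i>s\<close> shows that
  \<open>F(-\<i>s) = 0\<close> iff \<open>u'(b) = s u(b)\<close>: for \<open>s = \<gamma>\<close> this says \<open>B = 0\<close>, and for \<open>s = -\<gamma>\<close> it excludes
  \<open>A = 0\<close>, because \<open>\<i>\<gamma>\<close> is not a bound state.
\<close>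

section \<open>Solutions with integrable coefficients and their Wronskian\<close>

text \<open>The real form of the equation at \<open>k = \<i>s\<close>, with
  \<open>q = V + s\<^sup>2\<close>. The derivative is a parameter because Wronskians need its
  values; the left endpoint \<open>a\<close> is free so that a solution can be compared on
  \<open>[b, \<infinity>)\<close> with an exponential that solves the equation only there.\<close>

definition sl_solution :: "(real \<Rightarrow> real) \<Rightarrow> real \<Rightarrow> (real \<Rightarrow> real) \<Rightarrow> (real \<Rightarrow> real) \<Rightarrow> bool" where
  "sl_solution q a u u' \<longleftrightarrow>
     (\<forall>x\<ge>a. (u has_real_derivative u' x) (at x within {a..}) \<and>
            ((\<lambda>t. q t * u t) has_integral (u' x - u' a)) {a..x})"

lemma sl_solution_deriv:
  "sl_solution q a u u' \<Longrightarrow> a \<le> x \<Longrightarrow> (u has_real_derivative u' x) (at x within {a..})"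
  by (simp add: sl_solution_def)

lemma sl_solution_integral:
  assumes "sl_solution q a u u'" "a \<le> x" "x \<le> y"
  shows "((\<lambda>t. q t * u t) has_integral (u' y - u' x)) {x..y}"
proof -
  let ?f = "\<lambda>t. q t * u t"
  have x: "(?f has_integral (u' x - u' a)) {a..x}" and y: "(?f has_integral (u' y - u' a)) {a..y}"
    using assms by (auto simp: sl_solution_def)
  have "?f integrable_on {x..y}"
    using has_integral_integrable[OF y] by (rule integrable_subinterval_real) (use assms in auto)
  then obtain i where i: "(?f has_integral i) {x..y}" by (auto simp: integrable_on_def)
  have "u' x - u' a + i = u' y - u' a"
    using has_integral_combine[OF assms(2,3) x i] y has_integral_unique by blast
  then have "i = u' y - u' x" by simp
  with i show ?thesis by simp
qed

lemma sl_solution_restrict: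
  assumes "sl_solution q a u u'" "a \<le> b"
  shows "sl_solution q b u u'"
  unfolding sl_solution_def
proof (intro allI impI conjI)
  fix x assume "b \<le> x"
  then show "(u has_real_derivative u' x) (at x within {b..})"
    using DERIV_subset[OF sl_solution_deriv[OF assms(1)], of x "{b..}"] assms(2) by auto
  show "((\<lambda>t. q t * u t) has_integral (u' x - u' b)) {b..x}"
    using sl_solution_integral[OF assms] \<open>b \<le> x\<close> by simp
qed

lemma sl_solution_continuous_on:
  assumes "sl_solution q a u u'"
  shows "continuous_on {a..c} u"
proof -
  have "continuous_on {a..} u"
    using DERIV_continuous_on[of "{a..}" u u'] sl_solution_deriv[OF assms] by auto
  then show ?thesis by (rule continuous_on_subset) auto
qed

lemma sl_solution_continuous_on_deriv:
  assumes "sl_solution q a u u'"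
  shows "continuous_on {a..c} u'"
proof (cases "a \<le> c")
  case True
  let ?f = "\<lambda>t. q t * u t"
  have "?f integrable_on {a..c}"
    using sl_solution_integral[OF assms order_refl True] by (auto simp: integrable_on_def)
  from indefinite_integral_continuous_1[OF this]
  have "continuous_on {a..c} (\<lambda>x. u' a + integral {a..x} ?f)"
    by (intro continuous_intros)
  then show ?thesis
    by (rule continuous_on_eq) (use integral_unique[OF sl_solution_integral[OF assms order_refl]] in simp)
qed auto

text \<open>
  The Wronskian is only absolutely continuous, so it is not differentiable everywhere; its
  increments are instead estimated by those of \<open>x + \<integral>|q|\<close> and summed up over a fine partition.
\<close>

lemma sl_wronskian_constant:
  assumes q: "\<And>c. q absolutely_integrable_on {a..c}"
    and u: "sl_solution q a u u'" and v: "sl_solution q a v v'" and "a \<le> c"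
  shows "u c * v' c - u' c * v c = u a * v' a - u' a * v a"
proof -
  define w where "w x = u x * v' x - u' x * v x" for x
  \<comment> \<open>The length \<open>z - y\<close> will absorb the first-order remainders of
    \<open>u\<close> and \<open>v\<close>, the integral of \<open>\<bar>q\<bar>\<close> the
    increments of \<open>u'\<close> and \<open>v'\<close>.\<close>
  define G where "G y z = (z - y) + integral {y..z} (\<lambda>t. \<bar>q t\<bar>)" for y z :: real
  have q1: "(\<lambda>t. \<bar>q t\<bar>) integrable_on {y..z}" if "a \<le> y" for y z
  proof -
    have "(\<lambda>t. norm (q t)) integrable_on {a..z}"
      using q[of z] unfolding absolutely_integrable_on_def by (rule conjunct2)
    then have "(\<lambda>t. norm (q t)) integrable_on {y..z}"
      by (rule integrable_subinterval_real) (use that in auto)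
    then show ?thesis by simp
  qed
  have "bounded (u ` {a..c})" "bounded (v ` {a..c})"
    using u v by (auto intro!: compact_imp_bounded compact_continuous_image intro: sl_solution_continuous_on)
  then obtain M1 M2 where "\<forall>t\<in>u ` {a..c}. norm t \<le> M1" "\<forall>t\<in>v ` {a..c}. norm t \<le> M2"
    unfolding bounded_iff by blast
  then have M1: "\<And>t. t \<in> {a..c} \<Longrightarrow> \<bar>u t\<bar> \<le> M1" and M2: "\<And>t. t \<in> {a..c} \<Longrightarrow> \<bar>v t\<bar> \<le> M2"
    by simp_all
  have bound: "\<bar>w c - w a\<bar> \<le> e * G a c" if "0 < e" for e
  proof -
    \<comment> \<open>Bolzano's bisection principle does the summation: \<open>P\<close> is additive
      over adjacent intervals, so it only has to be checked near each point. The guard is there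
      because the local intervals around \<open>x\<close> may stick out of
      \<open>[a, c]\<close>.\<close>
    define P where "P y z \<longleftrightarrow> (a \<le> y \<and> z \<le> c \<longrightarrow> \<bar>w z - w y\<bar> \<le> e * G y z)" for y z
    have G_add: "G y s + G s z = G y z" if "a \<le> y" "y \<le> s" "s \<le> z" for y s z
      using Henstock_Kurzweil_Integration.integral_combine[OF that(2,3) q1[OF that(1)]] by (simp add: G_def)
    have "P a c"
    proof (rule Bolzano[OF \<open>a \<le> c\<close>])
      fix y s z assume ysz: "P y s" "P s z" "y \<le> s" "s \<le> z"
      show "P y z"
        unfolding P_def
      proof
        assume yz: "a \<le> y \<and> z \<le> c"
        then have "\<bar>w s - w y\<bar> \<le> e * G y s" "\<bar>w z - w s\<bar> \<le> e * G s z"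
          using ysz by (auto simp: P_def)
        moreover have "e * G y z = e * G y s + e * G s z"
          using G_add[of y s z] yz ysz by (simp flip: distrib_left)
        ultimately show "\<bar>w z - w y\<bar> \<le> e * G y z" by linarith
      qed
    next
      fix x assume local: "a \<le> x" "x \<le> c"
      \<comment> \<open>\<open>M\<close> bounds \<open>u\<close> and \<open>v\<close> on
        \<open>[a, c]\<close> and both derivatives at \<open>x\<close>; the summand 1 makes it
        positive. With \<open>\<delta> = e / (4 * M)\<close>, two products bounded by
        \<open>2 * \<delta> * M\<close> add up to exactly \<open>e\<close>.\<close>
      define M where "M = 1 + \<bar>M1\<bar> + \<bar>M2\<bar> + \<bar>u' x\<bar> + \<bar>v' x\<bar>"
      have M: "0 < M" "M1 \<le> M" "M2 \<le> M" "\<bar>u' x\<bar> \<le> M" "\<bar>v' x\<bar> \<le> M"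
        by (simp_all add: M_def)
      define \<delta> where "\<delta> = e / (4 * M)"
      have \<delta>: "0 < \<delta>" "4 * M * \<delta> = e" using M \<open>0 < e\<close> by (auto simp: \<delta>_def)
      have small: "\<exists>d>0. \<forall>y\<ge>a. \<bar>y - x\<bar> < d \<longrightarrow>
          \<bar>f y - f x\<bar> \<le> \<delta> \<and> \<bar>f y - f x - f' * (y - x)\<bar> \<le> \<delta> * \<bar>y - x\<bar>"
        if f: "(f has_real_derivative f') (at x within {a..})" for f f'
      proof -
        obtain d1 where d1: "d1 > 0"
          "\<And>y. y \<in> {a..} \<Longrightarrow> \<bar>y - x\<bar> < d1 \<Longrightarrow> \<bar>f y - f x - f' * (y - x)\<bar> \<le> \<delta> * \<bar>y - x\<bar>"
          using f \<delta>(1) unfolding has_field_derivative_def has_derivative_within_alt real_norm_def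
          by (elim conjE allE[of _ \<delta>]) auto
        have "continuous (at x within {a..}) f" using f by (rule DERIV_continuous)
        then obtain d2 where d2: "d2 > 0" "\<And>y. y \<in> {a..} \<Longrightarrow> \<bar>y - x\<bar> < d2 \<Longrightarrow> \<bar>f y - f x\<bar> < \<delta>"
          using \<delta>(1) unfolding continuous_within_eps_delta dist_real_def by (elim allE[of _ \<delta>]) auto
        show ?thesis using d1 d2 by (intro exI[of _ "min d1 d2"]) (auto intro: less_imp_le)
      qed
      obtain d1 d2 where d: "d1 > 0" "d2 > 0"
        and d1: "\<And>y. a \<le> y \<Longrightarrow> \<bar>y - x\<bar> < d1 \<Longrightarrow> \<bar>u y - u x\<bar> \<le> \<delta> \<and> \<bar>u y - u x - u' x * (y - x)\<bar> \<le> \<delta> * \<bar>y - x\<bar>"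
        and d2: "\<And>y. a \<le> y \<Longrightarrow> \<bar>y - x\<bar> < d2 \<Longrightarrow> \<bar>v y - v x\<bar> \<le> \<delta> \<and> \<bar>v y - v x - v' x * (y - x)\<bar> \<le> \<delta> * \<bar>y - x\<bar>"
        using small[OF sl_solution_deriv[OF u local(1)]] small[OF sl_solution_deriv[OF v local(1)]]
        by (elim exE conjE) metis
      \<comment> \<open>The factor next to \<open>q t\<close> vanishes for \<open>t = s\<close>,
        hence is small as long as both points are close to \<open>x\<close>.\<close>
      have H: "\<bar>q t * (u s * v t - v s * u t)\<bar> \<le> e * \<bar>q t\<bar>"
        if s: "a \<le> s" "s \<le> c" "\<bar>s - x\<bar> < min d1 d2" and t: "a \<le> t" "t \<le> c" "\<bar>t - x\<bar> < min d1 d2" for s t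
      proof -
        have "\<bar>u s - u x\<bar> \<le> \<delta>" "\<bar>u t - u x\<bar> \<le> \<delta>" "\<bar>v s - v x\<bar> \<le> \<delta>" "\<bar>v t - v x\<bar> \<le> \<delta>"
          using d1[of s] d1[of t] d2[of s] d2[of t] s t by auto
        then have "\<bar>u s - u t\<bar> \<le> 2 * \<delta>" "\<bar>v s - v t\<bar> \<le> 2 * \<delta>" by linarith+
        moreover have "\<bar>u t\<bar> \<le> M" "\<bar>v t\<bar> \<le> M" using M M1[of t] M2[of t] t by auto
        ultimately have "\<bar>(u s - u t) * v t\<bar> \<le> 2 * \<delta> * M" "\<bar>(v s - v t) * u t\<bar> \<le> 2 * \<delta> * M"
          by (auto simp: abs_mult intro!: mult_mono)
        moreover have "u s * v t - v s * u t = (u s - u t) * v t - (v s - v t) * u t"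
          by (simp add: algebra_simps)
        moreover have "2 * \<delta> * M + 2 * \<delta> * M = e" using \<delta>(2) by (simp add: algebra_simps)
        ultimately have "\<bar>u s * v t - v s * u t\<bar> \<le> e" by linarith
        then have "\<bar>u s * v t - v s * u t\<bar> * \<bar>q t\<bar> \<le> e * \<bar>q t\<bar>"
          by (rule mult_right_mono) simp
        then show ?thesis by (simp only: abs_mult mult.commute)
      qed
      have L: "\<bar>v' x * (u s - u x - u' x * (s - x)) - u' x * (v s - v x - v' x * (s - x))\<bar> \<le> e * \<bar>s - x\<bar>"
        if s: "a \<le> s" "\<bar>s - x\<bar> < min d1 d2" for s
      proof -
        have "\<bar>v' x * (u s - u x - u' x * (s - x))\<bar> \<le> M * (\<delta> * \<bar>s - x\<bar>)"
          "\<bar>u' x * (v s - v x - v' x * (s - x))\<bar> \<le> M * (\<delta> * \<bar>s - x\<bar>)"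
          using d1[of s] d2[of s] s M by (auto simp: abs_mult intro!: mult_mono)
        then have "\<bar>v' x * (u s - u x - u' x * (s - x)) - u' x * (v s - v x - v' x * (s - x))\<bar>
            \<le> (2 * M * \<delta>) * \<bar>s - x\<bar>" by linarith
        also have "\<dots> \<le> e * \<bar>s - x\<bar>" using \<delta> M by (intro mult_right_mono) auto
        finally show ?thesis .
      qed
      \<comment> \<open>The first bracket involves only increments of \<open>u'\<close> and
        \<open>v'\<close>, the second only first-order remainders; in the latter the terms
        \<open>u' x * v' x * (s - x)\<close> cancel.\<close>
      have w_eq: "w s - w x = (u s * (v' s - v' x) - v s * (u' s - u' x))
          + (v' x * (u s - u x - u' x * (s - x)) - u' x * (v s - v x - v' x * (s - x)))" for s
        by (simp add: w_def algebra_simps)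
      \<comment> \<open>With \<open>u s\<close> and \<open>v s\<close> frozen as constants, the two
        integral equations combine to an integral of the expression bounded in
        \<open>H\<close>.\<close>
      have I: "\<bar>u s * (v' z - v' y) - v s * (u' z - u' y)\<bar> \<le> e * integral {y..z} (\<lambda>t. \<bar>q t\<bar>)"
        if "s \<in> {y..z}" "x \<in> {y..z}" "a \<le> y" "y \<le> z" "z \<le> c" "z - y < min d1 d2" for s y z
      proof -
        have "((\<lambda>t. u s * (q t * v t) - v s * (q t * u t)) has_integral
            (u s * (v' z - v' y) - v s * (u' z - u' y))) {y..z}"
          using that by (intro has_integral_diff has_integral_mult_right
              sl_solution_integral[OF u] sl_solution_integral[OF v]) auto
        then have i: "((\<lambda>t. q t * (u s * v t - v s * u t)) has_integral
            (u s * (v' z - v' y) - v s * (u' z - u' y))) {y..z}"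
          by (rule has_integral_eq[rotated]) (simp add: algebra_simps)
        have "norm (integral {y..z} (\<lambda>t. q t * (u s * v t - v s * u t))) \<le> integral {y..z} (\<lambda>t. e * \<bar>q t\<bar>)"
        proof (rule Henstock_Kurzweil_Integration.integral_norm_bound_integral)
          show "(\<lambda>t. q t * (u s * v t - v s * u t)) integrable_on {y..z}"
            using i by (rule has_integral_integrable)
          show "(\<lambda>t. e * \<bar>q t\<bar>) integrable_on {y..z}"
            using integrable_on_mult_right[OF q1[OF \<open>a \<le> y\<close>]] by simp
          fix t assume "t \<in> {y..z}"
          then have "\<bar>s - x\<bar> \<le> z - y" "\<bar>t - x\<bar> \<le> z - y" "a \<le> s" "s \<le> c" "a \<le> t" "t \<le> c"
            using that by auto
          then show "norm (q t * (u s * v t - v s * u t)) \<le> e * \<bar>q t\<bar>"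
            unfolding real_norm_def using that by (intro H) linarith+
        qed
        with i show ?thesis by (simp add: integral_unique)
      qed
      have R: "\<bar>w z - w x\<bar> \<le> e * G x z" if "x \<le> z" "z \<le> c" "z - x < min d1 d2" for z
        using I[of z x z] L[of z] w_eq[of z] that local by (simp add: G_def distrib_left)
      have Lf: "\<bar>w x - w y\<bar> \<le> e * G y x" if "a \<le> y" "y \<le> x" "x - y < min d1 d2" for y
      proof -
        have "u y * (v' y - v' x) - v y * (u' y - u' x) = - (u y * (v' x - v' y) - v y * (u' x - u' y))"
          by (simp add: algebra_simps)
        then show ?thesis
          using I[of y y x] L[of y] w_eq[of y] that local by (simp add: G_def distrib_left)
      qed
      show "\<exists>d>0. \<forall>y z. y \<le> x \<and> x \<le> z \<and> z - y < d \<longrightarrow> P y z"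
        unfolding P_def
      proof (intro exI[of _ "min d1 d2"] conjI allI impI)
        show "0 < min d1 d2" using d by simp
        fix y z assume yz: "y \<le> x \<and> x \<le> z \<and> z - y < min d1 d2" "a \<le> y \<and> z \<le> c"
        then have "\<bar>w x - w y\<bar> \<le> e * G y x" "\<bar>w z - w x\<bar> \<le> e * G x z"
          by (auto intro!: R Lf)
        moreover have "e * G y z = e * G y x + e * G x z"
          using G_add[of y x z] yz by (simp flip: distrib_left)
        ultimately show "\<bar>w z - w y\<bar> \<le> e * G y z" by linarith
      qed
    qed
    then show ?thesis by (simp add: P_def)
  qed
  have "0 \<le> G a c"
    unfolding G_def using \<open>a \<le> c\<close> q1[of a c] by (intro add_nonneg_nonneg Henstock_Kurzweil_Integration.integral_nonneg) auto
  then have "\<bar>w c - w a\<bar> \<le> 0 + e" if "0 < e" for e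
  proof -
    \<comment> \<open>Adding 1 keeps the denominator positive also for \<open>a = c\<close>, where
      \<open>G a c\<close> vanishes.\<close>
    have "\<bar>w c - w a\<bar> \<le> e / (G a c + 1) * G a c"
      using that \<open>0 \<le> G a c\<close> by (intro bound divide_pos_pos) auto
    also have "\<dots> \<le> e" using that \<open>0 \<le> G a c\<close> by (simp add: field_simps)
    finally show ?thesis by simp
  qed
  then have "\<bar>w c - w a\<bar> \<le> 0" by (rule field_le_epsilon)
  then show ?thesis by (simp add: w_def)
qed

section \<open>Zeros of the Jost function\<close>

text \<open>Links the almost-everywhere hypotheses to the gauge integral, whose spike rules ask for
  negligible exceptional sets.\<close>

lemma AE_lebesgue_iff_negligible: "(AE x in lebesgue. P x) \<longleftrightarrow> negligible {x. \<not> P x}"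
proof
  assume "AE x in lebesgue. P x"
  then obtain N where "N \<in> null_sets lebesgue" "{x. \<not> P x} \<subseteq> N"
    by (auto simp: eventually_ae_filter)
  then show "negligible {x. \<not> P x}"
    using negligible_subset negligible_iff_null_sets by blast
next
  assume "negligible {x. \<not> P x}"
  then have "{x. \<not> P x} \<in> null_sets lebesgue" by (simp only: negligible_iff_null_sets)
  then show "AE x in lebesgue. P x" by (auto simp: eventually_ae_filter)
qed

text \<open>Makes one-sided derivatives unique, also at the left endpoint; initial data at 0 and
  comparisons at \<open>b\<close> rely on this.\<close>

lemma at_within_atLeast_neq_bot: "b \<le> x \<Longrightarrow> at x within {b..} \<noteq> bot" for x b :: real
proof
  assume "b \<le> x" and bot: "at x within {b..} = bot"
  have "{x<..} \<subseteq> {b..}" using \<open>b \<le> x\<close> by auto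
  then have "at_right x \<le> bot" unfolding bot[symmetric] by (rule at_le)
  then show False by (simp add: bot_unique)
qed

text \<open>At \<open>k = \<i>s\<close> the coefficient \<open>V - k\<^sup>2 = V + s\<^sup>2\<close>
  is real, so a map that is linear over the reals commutes with the equation. It is applied to
  \<open>Re\<close> and \<open>Im\<close>.\<close>

lemma sl_solution_linear_image:
  assumes \<psi>: "\<And>x. 0 \<le> x \<Longrightarrow> (\<psi> has_vector_derivative \<psi>' x) (at x within {0..})"
    "\<And>x. 0 \<le> x \<Longrightarrow> ((\<lambda>t. (complex_of_real (V t) - (\<i> * complex_of_real s)\<^sup>2) * \<psi> t) has_integral
      (\<psi>' x - \<psi>' 0)) {0..x}"
    and h: "bounded_linear h" "\<And>r z. h (complex_of_real r * z) = r * h z"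
  shows "sl_solution (\<lambda>x. V x + s\<^sup>2) 0 (\<lambda>x. h (\<psi> x)) (\<lambda>x. h (\<psi>' x))"
  unfolding sl_solution_def
proof (intro allI impI conjI)
  interpret h: bounded_linear h by fact
  fix x :: real assume x: "0 \<le> x"
  show "((\<lambda>x. h (\<psi> x)) has_real_derivative h (\<psi>' x)) (at x within {0..})"
    unfolding has_real_derivative_iff_has_vector_derivative
    by (rule h.has_vector_derivative[OF \<psi>(1)[OF x]])
  have "h ((complex_of_real (V t) - (\<i> * complex_of_real s)\<^sup>2) * \<psi> t) = (V t + s\<^sup>2) * h (\<psi> t)" for t
    using h(2)[of "V t + s\<^sup>2" "\<psi> t"] by (simp add: power_mult_distrib)
  then show "((\<lambda>t. (V t + s\<^sup>2) * h (\<psi> t)) has_integral h (\<psi>' x) - h (\<psi>' 0)) {0..x}"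
    using has_integral_linear[OF \<psi>(2)[OF x] h(1)] by (simp add: o_def h.diff)
qed

lemma schroedinger_solution_imp_sl_solution:
  assumes "schroedinger_solution V (\<i> * complex_of_real s) \<psi>"
  obtains \<psi>' where "\<And>x. 0 \<le> x \<Longrightarrow> (\<psi> has_vector_derivative \<psi>' x) (at x within {0..})"
    "sl_solution (\<lambda>x. V x + s\<^sup>2) 0 (\<lambda>x. Re (\<psi> x)) (\<lambda>x. Re (\<psi>' x))"
    "sl_solution (\<lambda>x. V x + s\<^sup>2) 0 (\<lambda>x. Im (\<psi> x)) (\<lambda>x. Im (\<psi>' x))"
proof -
  obtain \<psi>' where d: "\<And>x. 0 \<le> x \<Longrightarrow> (\<psi> has_vector_derivative \<psi>' x) (at x within {0..})"
    and i: "\<And>x. 0 \<le> x \<Longrightarrow> ((\<lambda>t. (complex_of_real (V t) - (\<i> * complex_of_real s)\<^sup>2) * \<psi> t) has_integral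
      (\<psi>' x - \<psi>' 0)) {0..x}"
    using assms unfolding schroedinger_solution_def by blast
  show ?thesis
    using d sl_solution_linear_image[OF d i bounded_linear_Re] sl_solution_linear_image[OF d i bounded_linear_Im]
    by (intro that) simp_all
qed

lemma sl_solution_exp:
  assumes "AE x in lebesgue. b < x \<longrightarrow> V x = 0"
  shows "sl_solution (\<lambda>x. V x + s\<^sup>2) b (\<lambda>x. exp (s * x)) (\<lambda>x. s * exp (s * x))"
  unfolding sl_solution_def
proof (intro allI impI conjI)
  fix x assume "b \<le> x"
  show "((\<lambda>x. exp (s * x)) has_real_derivative s * exp (s * x)) (at x within {b..})"
    by (auto intro!: derivative_eq_intros)
  have "((\<lambda>t. s\<^sup>2 * exp (s * t)) has_integral (s * exp (s * x) - s * exp (s * b))) {b..x}"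
    using \<open>b \<le> x\<close> by (intro fundamental_theorem_of_calculus)
      (auto simp: power2_eq_square simp flip: has_real_derivative_iff_has_vector_derivative
        intro!: derivative_eq_intros)
  \<comment> \<open>The hypothesis says nothing about \<open>V b\<close>, so the endpoint joins the
    exceptional set.\<close>
  moreover have "negligible (insert b {x. \<not> (b < x \<longrightarrow> V x = 0)})"
    using assms by (simp add: AE_lebesgue_iff_negligible)
  ultimately show "((\<lambda>t. (V t + s\<^sup>2) * exp (s * t)) has_integral (s * exp (s * x) - s * exp (s * b))) {b..x}"
    by (rule has_integral_spike[rotated 2]) auto
qed

lemma absolutely_integrable_on_Icc_add_const:
  fixes V :: "real \<Rightarrow> real"
  assumes "V absolutely_integrable_on {0<..}" "0 \<le> a"
  shows "(\<lambda>x. V x + c) absolutely_integrable_on {a..d}"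
proof -
  have "V absolutely_integrable_on {0<..<d}"
    using assms(1) by (rule set_integrable_subset) auto
  then have "V absolutely_integrable_on {0..d}"
    by (simp add: absolutely_integrable_on_Icc_iff_Ioo)
  then have "V absolutely_integrable_on {a..d}"
    by (rule absolutely_integrable_on_subinterval) (use assms(2) in auto)
  moreover have "(\<lambda>x. c) absolutely_integrable_on {a..d}"
    by (intro absolutely_integrable_continuous_real continuous_intros)
  ultimately show ?thesis by (rule set_integral_add)
qed

text \<open>This is the Wronskian of \<open>u\<close> with \<open>exp (s * x)\<close> on
  \<open>[b, x]\<close>. For \<open>s \<noteq> 0\<close> it equals \<open>2 * s\<close> times the
  coefficient of \<open>exp (- s * x)\<close> in \<open>u\<close> beyond \<open>b\<close>, which is
  thus available without solving the equation there.\<close>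

lemma sl_wronskian_exp:
  assumes V: "V absolutely_integrable_on {0<..}" and b: "0 \<le> b"
    and Vb: "AE x in lebesgue. b < x \<longrightarrow> V x = 0"
    and u: "sl_solution (\<lambda>x. V x + s\<^sup>2) 0 u u'" and "b \<le> x"
  shows "(s * u x - u' x) * exp (s * x) = (s * u b - u' b) * exp (s * b)"
proof -
  have "u x * (s * exp (s * x)) - u' x * exp (s * x) = u b * (s * exp (s * b)) - u' b * exp (s * b)"
    by (rule sl_wronskian_constant[OF absolutely_integrable_on_Icc_add_const[OF V b]
          sl_solution_restrict[OF u b] sl_solution_exp[OF Vb] \<open>b \<le> x\<close>])
  then show ?thesis by (simp add: algebra_simps)
qed

text \<open>By the initial data of \<open>u\<close>, \<open>F\<close> at \<open>-\<i>s\<close> is,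
  up to a nonzero factor, the Wronskian of \<open>u\<close> and the Jost solution at 0. There
  \<open>\<i>k = s\<close>, so the Jost solution is eventually the real function
  \<open>exp (s * x)\<close>: its imaginary part contributes nothing, and its real part gives the
  condition at \<open>b\<close>. Both signs of \<open>s\<close> will be used.\<close>

lemma jost_function_zero_iff:
  assumes V: "V absolutely_integrable_on {0<..}" and b: "0 \<le> b"
    and Vb: "AE x in lebesgue. b < x \<longrightarrow> V x = 0"
    and F: "jost_function V \<theta> F"
    and u: "sl_solution (\<lambda>x. V x + s\<^sup>2) 0 u u'"
    and init: "if \<theta> = pi then u 0 = 0 \<and> u' 0 = 1 else u 0 = 1 \<and> u' 0 = - cot \<theta>"
  shows "F (- \<i> * complex_of_real s) = 0 \<longleftrightarrow> u' b = s * u b"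
proof -
  define k where "k = - \<i> * complex_of_real s"
  obtain f where f: "jost_solution V k f" and Fk: "F k = (if \<theta> = pi then f 0
      else - \<i> * (vector_derivative f (at 0 within {0..}) + complex_of_real (cot \<theta>) * f 0))"
    using F unfolding jost_function_def by blast
  have "schroedinger_solution V (\<i> * complex_of_real (- s)) f"
    using f by (simp add: jost_solution_def k_def)
  then obtain f' where f': "\<And>x. 0 \<le> x \<Longrightarrow> (f has_vector_derivative f' x) (at x within {0..})"
    and Re: "sl_solution (\<lambda>x. V x + s\<^sup>2) 0 (\<lambda>x. Re (f x)) (\<lambda>x. Re (f' x))"
    and Im: "sl_solution (\<lambda>x. V x + s\<^sup>2) 0 (\<lambda>x. Im (f x)) (\<lambda>x. Im (f' x))"
    by (rule schroedinger_solution_imp_sl_solution) auto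
  obtain b' where b': "\<And>x. b' \<le> x \<Longrightarrow> f x = exp (\<i> * k * complex_of_real x)"
    using f by (auto simp: jost_solution_def)
  \<comment> \<open>The Jost solution may become exponential only beyond its own \<open>b'\<close>.
    The Wronskian is evaluated at \<open>B\<close> first and then carried back to \<open>b\<close>
    by \<open>sl_wronskian_exp\<close>.\<close>
  define B where "B = max b b'"
  have B: "0 \<le> B" "b \<le> B" "b' \<le> B" using b by (auto simp: B_def)
  have f_exp: "f x = complex_of_real (exp (s * x))" if "B \<le> x" for x
    using b'[of x] that B by (simp add: k_def exp_of_real[symmetric])
  \<comment> \<open>Since the explicit form of \<open>f\<close> is known only on
    \<open>[B, \<infinity>)\<close>, \<open>f' B\<close> is identified through the right-hand
    derivative.\<close>
  have "((\<lambda>x. complex_of_real (exp (s * x))) has_vector_derivative complex_of_real (s * exp (s * B)))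
      (at B within {B..})"
    by (intro has_vector_derivative_of_real) (auto intro!: derivative_eq_intros)
  then have "(f has_vector_derivative complex_of_real (s * exp (s * B))) (at B within {B..})"
    by (rule has_vector_derivative_transform[rotated 2]) (auto simp: f_exp)
  moreover have "(f has_vector_derivative f' B) (at B within {B..})"
    using has_vector_derivative_within_subset[OF f'[OF B(1)], of "{B..}"] B(1) by auto
  ultimately have f'B: "f' B = complex_of_real (s * exp (s * B))"
    by (intro vector_derivative_unique_within[OF at_within_atLeast_neq_bot[OF order_refl]])
  note W = sl_wronskian_constant[OF absolutely_integrable_on_Icc_add_const[OF V order_refl] u _ B(1)]
  have "u 0 * Re (f' 0) - u' 0 * Re (f 0) = (s * u B - u' B) * exp (s * B)"
    using W[OF Re] by (simp add: f'B f_exp algebra_simps)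
  also have "\<dots> = (s * u b - u' b) * exp (s * b)"
    by (rule sl_wronskian_exp[OF V b Vb u B(2)])
  finally have 1: "u 0 * Re (f' 0) - u' 0 * Re (f 0) = 0 \<longleftrightarrow> u' b = s * u b" by auto
  have 2: "u 0 * Im (f' 0) - u' 0 * Im (f 0) = 0"
    using W[OF Im] by (simp add: f'B f_exp)
  have "vector_derivative f (at 0 within {0..}) = f' 0"
    by (intro vector_derivative_within at_within_atLeast_neq_bot f') auto
  then have "F k = 0 \<longleftrightarrow> u 0 * Re (f' 0) - u' 0 * Re (f 0) = 0"
    using 2 init by (auto simp: Fk complex_eq_iff split: if_splits)
  then show ?thesis using 1 by (simp add: k_def)
qed

section \<open>The Darboux step\<close>

locale darboux_step =
  fixes V u u' :: "real \<Rightarrow> real" and b \<gamma> g :: real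
  assumes V_int: "V absolutely_integrable_on {0<..}"
    and b_nonneg: "0 \<le> b"
    and V_zero: "AE x in lebesgue. b < x \<longrightarrow> V x = 0"
    and \<gamma>_pos: "0 < \<gamma>" and g_pos: "0 < g"
    and u_sol: "sl_solution (\<lambda>x. V x + \<gamma>\<^sup>2) 0 u u'"
begin

definition D :: "real \<Rightarrow> real" where "D x = 1 + g\<^sup>2 * integral {0..x} (\<lambda>y. (u y)\<^sup>2)"

definition p :: "real \<Rightarrow> real" where "p x = 2 * g\<^sup>2 * (u x)\<^sup>2 / D x"

definition p' :: "real \<Rightarrow> real" where
  "p' x = (4 * g\<^sup>2 * (u x * u' x) * D x - 2 * g\<^sup>2 * (u x)\<^sup>2 * (g\<^sup>2 * (u x)\<^sup>2)) / (D x)\<^sup>2"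

lemma D_pos: "0 < D x"
proof -
  have "0 \<le> integral {0..x} (\<lambda>y. (u y)\<^sup>2)"
    by (intro Henstock_Kurzweil_Integration.integral_nonneg integrable_continuous_real
        continuous_intros sl_solution_continuous_on[OF u_sol]) auto
  then show ?thesis by (simp add: D_def add_pos_nonneg)
qed

lemma D_deriv:
  assumes "0 \<le> x"
  shows "(D has_real_derivative g\<^sup>2 * (u x)\<^sup>2) (at x within {0..})"
proof -
  \<comment> \<open>The fundamental theorem is stated on compact intervals; ending at
    \<open>x + 1\<close> keeps \<open>x\<close> off the right endpoint, so the filter agrees with
    the one for \<open>{0..}\<close>.\<close>
  have "((\<lambda>x. integral {0..x} (\<lambda>y. (u y)\<^sup>2)) has_real_derivative (u x)\<^sup>2) (at x within {0..x + 1})"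
    using assms by (intro integral_has_real_derivative continuous_intros sl_solution_continuous_on[OF u_sol]) auto
  moreover have "at x within {0..x + 1} = at x within {0..}"
    by (rule at_within_nhd[of _ "{x - 1<..<x + 1}"]) auto
  ultimately show ?thesis
    unfolding D_def by (auto intro!: derivative_eq_intros)
qed

lemma p_deriv:
  assumes "0 \<le> x"
  shows "(p has_real_derivative p' x) (at x within {0..})"
proof -
  have "((\<lambda>x. 2 * g\<^sup>2 * (u x)\<^sup>2 / D x) has_real_derivative p' x) (at x within {0..})"
    using D_pos[of x]
    by (auto intro!: derivative_eq_intros D_deriv[OF assms] sl_solution_deriv[OF u_sol assms]
        simp: p'_def power2_eq_square)
  then show ?thesis by (simp add: p_def[abs_def])
qed

lemma p_deriv_at: "0 < x \<Longrightarrow> (p has_real_derivative p' x) (at x)"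
  using p_deriv[of x] at_within_interior[of x "{0..}"] by simp

text \<open>The closed form of \<open>p'\<close> contains \<open>u\<close>, \<open>u'\<close> and
  \<open>D\<close> but not \<open>V\<close>, so the Darboux correction is continuous although
  \<open>V\<close> is merely integrable.\<close>

lemma p'_continuous: "continuous_on {0..c} p'"
proof -
  have "continuous_on {0..} D" using D_deriv by (intro DERIV_continuous_on) auto
  then have "continuous_on {0..c} D" by (rule continuous_on_subset) auto
  then show ?thesis
    unfolding p'_def using D_pos
    by (intro continuous_intros sl_solution_continuous_on[OF u_sol]
        sl_solution_continuous_on_deriv[OF u_sol]) (auto simp: less_imp_neq[symmetric])
qed

text \<open>If \<open>u = A exp(\<gamma>x) + B exp(-\<gamma>x)\<close> beyond \<open>b\<close>, the
  two constants are \<open>2\<gamma>B\<close> and \<open>2\<gamma>A\<close>. The second relation is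
  the first Wronskian identity with \<open>-\<gamma>\<close> for \<open>\<gamma>\<close>, which
  leaves the equation unchanged.\<close>

lemma exp_relation:
  assumes "b \<le> x"
  shows "(\<gamma> * u x - u' x) * exp (\<gamma> * x) = (\<gamma> * u b - u' b) * exp (\<gamma> * b)"
    and "(\<gamma> * u x + u' x) * exp (- \<gamma> * x) = (\<gamma> * u b + u' b) * exp (- \<gamma> * b)"
proof -
  show "(\<gamma> * u x - u' x) * exp (\<gamma> * x) = (\<gamma> * u b - u' b) * exp (\<gamma> * b)"
    by (rule sl_wronskian_exp[OF V_int b_nonneg V_zero u_sol assms])
  have "(- \<gamma> * u x - u' x) * exp (- \<gamma> * x) = (- \<gamma> * u b - u' b) * exp (- \<gamma> * b)"
    by (rule sl_wronskian_exp[OF V_int b_nonneg V_zero _ assms]) (use u_sol in simp)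
  then show "(\<gamma> * u x + u' x) * exp (- \<gamma> * x) = (\<gamma> * u b + u' b) * exp (- \<gamma> * b)"
    by (simp add: algebra_simps)
qed

lemma p_constant_imp:
  assumes not_bound: "u' b \<noteq> - \<gamma> * u b" and p: "\<And>x. b \<le> x \<Longrightarrow> p x = c"
  shows "u' b = \<gamma> * u b \<and> g\<^sup>2 * (u b)\<^sup>2 = 2 * \<gamma> * D b"
proof -
  have eq: "2 * g\<^sup>2 * (u x)\<^sup>2 = c * D x" if "b \<le> x" for x
    using p[OF that] D_pos[of x] by (simp add: p_def field_simps)
  have "4 * g\<^sup>2 * (u x * u' x) = c * (g\<^sup>2 * (u x)\<^sup>2)" if "b \<le> x" for x
  proof -
    have x: "0 \<le> x" "{b..} \<subseteq> {0..}" using that b_nonneg by auto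
    have 1: "((\<lambda>x. 2 * g\<^sup>2 * (u x)\<^sup>2) has_real_derivative 4 * g\<^sup>2 * (u x * u' x)) (at x within {b..})"
      by (auto intro!: derivative_eq_intros DERIV_subset[OF sl_solution_deriv[OF u_sol x(1)] x(2)])
    have "((\<lambda>x. c * D x) has_real_derivative c * (g\<^sup>2 * (u x)\<^sup>2)) (at x within {b..})"
      by (auto intro!: derivative_eq_intros DERIV_subset[OF D_deriv[OF x(1)] x(2)])
    then have 2: "((\<lambda>x. 2 * g\<^sup>2 * (u x)\<^sup>2) has_real_derivative c * (g\<^sup>2 * (u x)\<^sup>2)) (at x within {b..})"
      by (rule has_field_derivative_transform_within[where d=1]) (use eq that in auto)
    show ?thesis
      by (rule vector_derivative_unique_within[OF at_within_atLeast_neq_bot[OF that]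
            1[unfolded has_real_derivative_iff_has_vector_derivative]
            2[unfolded has_real_derivative_iff_has_vector_derivative]])
  qed
  then have logderiv: "4 * (u x * u' x) = c * (u x)\<^sup>2" if "b \<le> x" for x
    using that g_pos by (auto simp: power2_eq_square)
  have "0 \<le> c" using p[of b] D_pos[of b] by (auto simp: p_def)
  \<comment> \<open>For \<open>c = 0\<close> the solution vanishes on
    \<open>[b, \<infinity>)\<close>. The two exponential relations then prescribe
    \<open>u' (b + 1)\<close> with different factors, forcing \<open>u' b = 0\<close> and
    contradicting \<open>not_bound\<close>.\<close>
  have "c \<noteq> 0"
  proof
    assume "c = 0"
    then have u0: "u x = 0" if "b \<le> x" for x using eq[OF that] g_pos by simp
    have "u' (b + 1) = u' b * exp (- \<gamma>)"
      using exp_relation(1)[of "b + 1"] by (simp add: u0 distrib_left exp_add exp_minus field_simps)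
    moreover have "u' (b + 1) = u' b * exp \<gamma>"
      using exp_relation(2)[of "b + 1"] by (simp add: u0 distrib_left exp_add exp_minus exp_diff field_simps)
    ultimately have "u' b = 0" using \<gamma>_pos by auto
    then show False using not_bound u0[of b] by simp
  qed
  with \<open>0 \<le> c\<close> have c: "0 < c" by simp
  have u_nz: "u x \<noteq> 0" if "b \<le> x" for x
    using eq[OF that] c D_pos[of x] by auto
  have u': "u' x = c / 4 * u x" if "b \<le> x" for x
    using logderiv[OF that] u_nz[OF that] by (simp add: power2_eq_square)
  have "c / 4 = \<gamma>"
  \<comment> \<open>If neither \<open>\<gamma> - c / 4\<close> nor \<open>\<gamma> + c / 4\<close>
    is zero, both cancel from the relations between \<open>b\<close> and \<open>b + 1\<close>:
    \<open>u\<close> would shrink and grow by the factor \<open>exp \<gamma>\<close> at once. The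
    second factor is nonzero because \<open>c\<close> is positive.\<close>
  proof (rule ccontr)
    assume ne: "c / 4 \<noteq> \<gamma>"
    have "(\<gamma> - c / 4) * (u (b + 1) * exp \<gamma>) * exp (\<gamma> * b) = (\<gamma> - c / 4) * u b * exp (\<gamma> * b)"
      using exp_relation(1)[of "b + 1"] u'[of b] u'[of "b + 1"]
      by (simp only: distrib_left exp_add) (simp add: algebra_simps)
    then have "(\<gamma> - c / 4) * (u (b + 1) * exp \<gamma>) = (\<gamma> - c / 4) * u b"
      by (simp only: mult_right_cancel[OF exp_not_eq_zero])
    then have 1: "u (b + 1) * exp \<gamma> = u b" using ne by (simp only: mult_left_cancel right_minus_eq)
    have "- \<gamma> * (b + 1) = - \<gamma> + - \<gamma> * b" by (simp add: algebra_simps)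
    then have "exp (- \<gamma> * (b + 1)) = exp (- \<gamma>) * exp (- \<gamma> * b)" by (simp only: exp_add)
    then have "(\<gamma> + c / 4) * (u (b + 1) * exp (- \<gamma>)) * exp (- \<gamma> * b) = (\<gamma> + c / 4) * u b * exp (- \<gamma> * b)"
      using exp_relation(2)[of "b + 1"] u'[of b] u'[of "b + 1"]
      by (simp only:) (simp add: algebra_simps)
    then have "(\<gamma> + c / 4) * (u (b + 1) * exp (- \<gamma>)) = (\<gamma> + c / 4) * u b"
      by (simp only: mult_right_cancel[OF exp_not_eq_zero])
    then have 2: "u (b + 1) * exp (- \<gamma>) = u b" using c \<gamma>_pos by simp
    from 1 2 have "u (b + 1) * exp \<gamma> = u (b + 1) * exp (- \<gamma>)" by simp
    then show False using u_nz[of "b + 1"] \<gamma>_pos by simp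
  qed
  then have "c = 4 * \<gamma>" by simp
  then show ?thesis using u'[of b] eq[of b] by simp
qed

text \<open>The first exponential relation propagates \<open>u' = \<gamma> u\<close> from
  \<open>b\<close> to all larger points. Hence \<open>g\<^sup>2 u\<^sup>2 - 2\<gamma>D\<close> has
  derivative zero there, and its value at \<open>b\<close> is zero.\<close>

lemma p_constant:
  assumes "u' b = \<gamma> * u b" "g\<^sup>2 * (u b)\<^sup>2 = 2 * \<gamma> * D b" "b \<le> x"
  shows "p x = 4 * \<gamma>"
proof -
  define E where "E x = g\<^sup>2 * (u x)\<^sup>2 - 2 * \<gamma> * D x" for x
  have "(E has_real_derivative 0) (at x within {b..})" if "x \<in> {b..}" for x
  proof -
    have x: "0 \<le> x" "{b..} \<subseteq> {0..}" using that b_nonneg by auto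
    have "u' x = \<gamma> * u x" using exp_relation(1)[of x] that assms(1) by simp
    then show ?thesis
      unfolding E_def
      by (auto intro!: derivative_eq_intros DERIV_subset[OF D_deriv[OF x(1)] x(2)]
          DERIV_subset[OF sl_solution_deriv[OF u_sol x(1)] x(2)] simp: power2_eq_square)
  qed
  then obtain c where "\<forall>x\<in>{b..}. E x = c"
    using has_field_derivative_zero_constant[of "{b..}" E] by auto
  then have "E x = E b" using assms(3) by simp
  also have "E b = 0" using assms(2) by (simp add: E_def)
  finally show ?thesis using D_pos[of x] by (simp add: E_def p_def field_simps)
qed

text \<open>Vanishing almost everywhere suffices because \<open>p\<close> is recovered by
  integrating \<open>p'\<close>; conversely, constancy gives \<open>p' = 0\<close> at every point of
  the open half-line.\<close>

lemma p'_AE_zero_iff: "(AE x in lebesgue. b < x \<longrightarrow> p' x = 0) \<longleftrightarrow> (\<forall>x\<ge>b. p x = p b)"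
proof
  assume L: "AE x in lebesgue. b < x \<longrightarrow> p' x = 0"
  show "\<forall>x\<ge>b. p x = p b"
  proof (intro allI impI)
    fix x assume x: "b \<le> x"
    have "(p' has_integral (p x - p b)) {b..x}"
      using x b_nonneg by (intro fundamental_theorem_of_calculus)
        (auto simp flip: has_real_derivative_iff_has_vector_derivative intro: DERIV_subset[OF p_deriv])
    then have "p x - p b = 0"
    proof (rule has_integral_unique)
      show "(p' has_integral 0) {b..x}"
      by (rule has_integral_spike[OF _ _ has_integral_0, of "insert b {x. \<not> (b < x \<longrightarrow> p' x = 0)}"])
        (use L in \<open>auto simp: AE_lebesgue_iff_negligible\<close>)
    qed
    then show "p x = p b" by simp
  qed
next
  assume R: "\<forall>x\<ge>b. p x = p b"
  have "p' x = 0" if "b < x" for x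
  proof -
    have "(p has_real_derivative p' x) (at x)" using that b_nonneg by (intro p_deriv_at) simp
    then have "((\<lambda>_. p b) has_real_derivative p' x) (at x)"
    proof (rule has_field_derivative_transform_within_open)
      show "p y = p b" if "y \<in> {b<..}" for y
        using R[rule_format, of y] that by (simp only: greaterThan_iff less_imp_le)
    qed (use that in auto)
    then show ?thesis by (rule DERIV_unique) (rule DERIV_const)
  qed
  then show "AE x in lebesgue. b < x \<longrightarrow> p' x = 0" by simp
qed

lemma darboux_AE_zero_iff:
  assumes W: "AE x in lebesgue. 0 < x \<longrightarrow> W x = V x - p' x" and "u' b \<noteq> - \<gamma> * u b"
  shows "(AE x in lebesgue. b < x \<longrightarrow> W x = 0) \<longleftrightarrow> u' b = \<gamma> * u b \<and> g\<^sup>2 * (u b)\<^sup>2 = 2 * \<gamma> * D b"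
proof -
  have "AE x in lebesgue. (b < x \<longrightarrow> W x = 0) \<longleftrightarrow> (b < x \<longrightarrow> p' x = 0)"
    using W V_zero by eventually_elim (use b_nonneg in auto)
  then have "(AE x in lebesgue. b < x \<longrightarrow> W x = 0) \<longleftrightarrow> (AE x in lebesgue. b < x \<longrightarrow> p' x = 0)"
    by (rule eventually_subst)
  also have "\<dots> \<longleftrightarrow> u' b = \<gamma> * u b \<and> g\<^sup>2 * (u b)\<^sup>2 = 2 * \<gamma> * D b"
    unfolding p'_AE_zero_iff
  proof
    assume "\<forall>x\<ge>b. p x = p b"
    then show "u' b = \<gamma> * u b \<and> g\<^sup>2 * (u b)\<^sup>2 = 2 * \<gamma> * D b"
      by (intro p_constant_imp[OF assms(2)]) blast
  next
    assume "u' b = \<gamma> * u b \<and> g\<^sup>2 * (u b)\<^sup>2 = 2 * \<gamma> * D b"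
    then show "\<forall>x\<ge>b. p x = p b" using p_constant[of b] p_constant by auto
  qed
  finally show ?thesis .
qed

text \<open>Beyond \<open>b\<close> both \<open>W\<close> and \<open>V\<close> vanish almost
  everywhere, so the correction may be cut off to \<open>[0, b]\<close>, where \<open>p'\<close> is
  continuous and hence absolutely integrable.\<close>

lemma darboux_class_A:
  assumes W: "AE x in lebesgue. 0 < x \<longrightarrow> W x = V x - p' x"
    and Wb: "AE x in lebesgue. b < x \<longrightarrow> W x = 0"
  shows "W \<in> class_A"
proof -
  define q where "q x = (if x \<in> {0..b} then p' x else 0)" for x
  have "q absolutely_integrable_on UNIV"
    unfolding q_def absolutely_integrable_restrict_UNIV
    by (intro absolutely_integrable_continuous_real p'_continuous)
  then have "q absolutely_integrable_on {0<..}"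
    by (rule set_integrable_subset) auto
  with V_int have Vq: "(\<lambda>x. V x - q x) absolutely_integrable_on {0<..}"
    by (rule set_integral_diff)
  have "AE x in lebesgue. 0 < x \<longrightarrow> W x = V x - q x"
    using W Wb V_zero by eventually_elim (use b_nonneg in \<open>auto simp: q_def\<close>)
  then have "W absolutely_integrable_on {0<..}"
    unfolding AE_lebesgue_iff_negligible
    by (rule absolutely_integrable_spike[OF Vq]) auto
  then show ?thesis using Wb b_nonneg by (auto simp: class_A_def)
qed

end

section \<open>From the complex spectral data to the real Darboux step\<close>

theorem theorem3p5:
  fixes j :: nat
    and V W :: "real \<Rightarrow> real"
    and \<theta> \<theta>' b g :: real
    and \<gamma> :: "nat \<Rightarrow> real"
    and F :: "complex \<Rightarrow> complex"
    and \<phi> :: "complex \<Rightarrow> real \<Rightarrow> complex"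
  assumes "V \<in> class_A"
    and "0 < \<theta>" and "\<theta> \<le> pi"
    and "0 \<le> b" and "AE x in lebesgue. b < x \<longrightarrow> V x = 0"
    and "jost_function V \<theta> F"
    and "\<And>k. regular_solution V \<theta> k (\<phi> k)"
    and "bound_states F = (\<lambda>s. \<i> * complex_of_real (\<gamma> s)) ` {1..j}"
    and "0 < \<gamma> (Suc j)" and "\<gamma> (Suc j) \<notin> \<gamma> ` {1..j}"
    and "0 < g"
    and "adds_bound_state V \<theta> \<phi> (\<gamma> (Suc j)) g W \<theta>'"
  shows "let u = (\<lambda>y. Re (\<phi> (\<i> * complex_of_real (\<gamma> (Suc j))) y));
             R = 2 * \<gamma> (Suc j) /
                 ((u b)\<^sup>2 - 2 * \<gamma> (Suc j) * integral {0..b} (\<lambda>y. (u y)\<^sup>2));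
             C1 = (F (- \<i> * complex_of_real (\<gamma> (Suc j))) = 0);
             C2 = (g\<^sup>2 = R)
         in ((AE x in lebesgue. b < x \<longrightarrow> W x = 0) \<longleftrightarrow> C1 \<and> C2)
            \<and> (C2 \<longrightarrow> 0 < R)
            \<and> (C1 \<and> C2 \<longrightarrow> W \<in> class_A)"
proof -
  define c where "c = \<gamma> (Suc j)"
  define \<psi> where "\<psi> = \<phi> (\<i> * complex_of_real c)"
  define u where "u y = Re (\<psi> y)" for y
  have V: "V absolutely_integrable_on {0<..}" using assms(1) by (simp add: class_A_def)
  have reg: "regular_solution V \<theta> (\<i> * complex_of_real c) \<psi>"
    using assms(7) by (simp add: \<psi>_def)
  then obtain \<psi>' where \<psi>': "\<And>x. 0 \<le> x \<Longrightarrow> (\<psi> has_vector_derivative \<psi>' x) (at x within {0..})"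
    and Re: "sl_solution (\<lambda>x. V x + c\<^sup>2) 0 (\<lambda>x. Re (\<psi> x)) (\<lambda>x. Re (\<psi>' x))"
    unfolding regular_solution_def using schroedinger_solution_imp_sl_solution by metis
  define u' where "u' y = Re (\<psi>' y)" for y
  have u: "sl_solution (\<lambda>x. V x + c\<^sup>2) 0 u u'"
    using Re by (simp add: u_def[abs_def] u'_def[abs_def])
  have uniq: "\<psi>' 0 = d" if "(\<psi> has_vector_derivative d) (at 0 within {0..})" for d
    by (rule vector_derivative_unique_within[OF at_within_atLeast_neq_bot[OF order_refl] \<psi>'[OF order_refl] that])
  have init: "if \<theta> = pi then u 0 = 0 \<and> u' 0 = 1 else u 0 = 1 \<and> u' 0 = - cot \<theta>"
    using reg uniq unfolding regular_solution_def by (auto simp: u_def u'_def split: if_splits)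
  interpret darboux_step V u u' b c g
    by unfold_locales (use V assms u in \<open>auto simp: c_def\<close>)
  have "\<i> * complex_of_real c \<notin> bound_states F"
    using assms(8,10) by (auto simp: c_def)
  \<comment> \<open>The point \<open>\<i>c\<close> is written as \<open>-\<i>(-c)\<close>, so that
    the zero criterion applies with \<open>s = -c\<close>.\<close>
  then have "F (- \<i> * complex_of_real (- c)) \<noteq> 0"
    using assms(9) by (simp add: bound_states_def c_def)
  moreover have "sl_solution (\<lambda>x. V x + (- c)\<^sup>2) 0 u u'" using u by simp
  ultimately have not_bound: "u' b \<noteq> - c * u b"
    using jost_function_zero_iff[OF V assms(4,5,6), of "- c" u u'] init by blast
  have C1: "F (- \<i> * complex_of_real c) = 0 \<longleftrightarrow> u' b = c * u b"
    by (rule jost_function_zero_iff[OF V assms(4-6) u init])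
  define R where "R = 2 * c / ((u b)\<^sup>2 - 2 * c * integral {0..b} (\<lambda>y. (u y)\<^sup>2))"
  have C2: "g\<^sup>2 = R \<longleftrightarrow> g\<^sup>2 * (u b)\<^sup>2 = 2 * c * D b"
  \<comment> \<open>If the denominator is zero, division yields \<open>R = 0\<close>, which differs
    from \<open>g\<^sup>2\<close>; the other side then fails too, its two members differing by
    \<open>2 * c\<close>.\<close>
  proof (cases "(u b)\<^sup>2 - 2 * c * integral {0..b} (\<lambda>y. (u y)\<^sup>2) = 0")
    case True
    then have "g\<^sup>2 * (u b)\<^sup>2 = 2 * c * D b - 2 * c" by (simp add: D_def algebra_simps)
    then show ?thesis using True g_pos \<gamma>_pos by (simp add: R_def)
  next
    case False
    then show ?thesis by (simp add: R_def D_def field_simps)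
  qed
  have "AE x in lebesgue. 0 < x \<longrightarrow> W x = darboux_potential V \<phi> c g x"
    using assms(12) by (simp add: adds_bound_state_def c_def)
  \<comment> \<open>\<open>deriv\<close> is two-sided, so the closed form is claimed only at
    interior points of the half-line.\<close>
  moreover have "darboux_potential V \<phi> c g x = V x - p' x" if "0 < x" for x
    using DERIV_imp_deriv[OF p_deriv_at[OF that]] unfolding p_def[abs_def] D_def
    by (simp add: darboux_potential_def u_def \<psi>_def Let_def)
  ultimately have W: "AE x in lebesgue. 0 < x \<longrightarrow> W x = V x - p' x" by simp
  have iff: "(AE x in lebesgue. b < x \<longrightarrow> W x = 0) \<longleftrightarrow> F (- \<i> * complex_of_real c) = 0 \<and> g\<^sup>2 = R"
    using darboux_AE_zero_iff[OF W not_bound] C1 C2 by simp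
  moreover have "0 < R" if "g\<^sup>2 = R" using that g_pos by (metis zero_less_power)
  moreover have "W \<in> class_A" if "F (- \<i> * complex_of_real c) = 0 \<and> g\<^sup>2 = R"
    using darboux_class_A[OF W] iff that by blast
  ultimately show ?thesis
    unfolding Let_def c_def[symmetric] \<psi>_def[symmetric] u_def[symmetric] R_def[symmetric] by blast
qed

end
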